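(* Let $n\ge2$, identify $\mathrm{Free}_n(\mathbf{CH})$ with $G_n^+$ (with free generators $x_1,\ldots,x_n$), and let $\sigma$ be a nontrivial endomorphism of $\mathrm{Free}_n(\mathbf{CH})$. Let $f_i=\sigma(x_i)$ for $1\le i\le n$, let $f_\sharp=f_n+(f_1\lor\cdots\lor f_{n-1})=\sigma(\mathbf{1})$ (a strong unit, never zero, with $0\le f_i\le f_\sharp$ for $i\le n-1$), let $S_i(p)=f_i(p)/f_\sharp(p)$, and let $S:[0,1]^{n-1}\to[0,1]^{n-1}$ be $S(p)=(S_1(p),\ldots,S_{n-1}(p))$. Then, under the identification of $\mathrm{MaxSpec}\,\mathrm{Free}_n(\mathbf{CH})$ with $[0,1]^{n-1}$ given by $p\mapsto\{f\in\mathrm{Free}_n(\mathbf{CH}):f(p)=0\}$, the dual map of $\sigma$ is $S$.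
   Context: A cancellative hoop is an algebra $(A,+,\mathbin{\dot{-}},0)$ with $\mathbin{\dot{-}}$ a truncated difference (on positive cones of $\ell$-groups, $a\mathbin{\dot{-}}b=0\lor(a-b)$); $\mathrm{Free}_n(\mathbf{CH})$ is the free cancellative hoop on $n$ generators. $G_n$ is the $\ell$-group of all McNaughton functions $[0,1]^{n-1}\to\mathbb{R}$ (the $\ell$-group enveloping the free MV-algebra on $n-1$ generators, with strong unit $\mathbf{1}$, the constant function $1$); $x_1,\ldots,x_{n-1}$ are the coordinate projections and $x_n=\mathbf{1}-(x_1\lor\cdots\lor x_{n-1})$; $\mathrm{Free}_n(\mathbf{CH})\cong G_n^+$ with free generators $x_1,\ldots,x_n$. An endomorphism $\sigma$ is nontrivial if its image is not contained in any prime (equivalently, maximal) ideal, equivalently if it maps strong units to strong units. The dual map of $\sigma$ sends a maximal ideal $\mathfrak{m}$ to $\sigma^{-1}[\mathfrak{m}]$. *)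

theory Defs
  imports "HOL-Analysis.Analysis" "HOL-Algebra.Congruence"
begin

record 'a hoop = "'a partial_object" +
  hplus :: "'a \<Rightarrow> 'a \<Rightarrow> 'a"
  hdiff :: "'a \<Rightarrow> 'a \<Rightarrow> 'a"
  hzero :: "'a"

locale cancellative_hoop =
  fixes H :: "('a, 'b) hoop_scheme"
  assumes zero_closed: "hzero H \<in> carrier H"
    and plus_closed: "\<lbrakk>a \<in> carrier H; b \<in> carrier H\<rbrakk> \<Longrightarrow> hplus H a b \<in> carrier H"
    and diff_closed: "\<lbrakk>a \<in> carrier H; b \<in> carrier H\<rbrakk> \<Longrightarrow> hdiff H a b \<in> carrier H"
    and plus_assoc: "\<lbrakk>a \<in> carrier H; b \<in> carrier H; c \<in> carrier H\<rbrakk>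
      \<Longrightarrow> hplus H (hplus H a b) c = hplus H a (hplus H b c)"
    and plus_comm: "\<lbrakk>a \<in> carrier H; b \<in> carrier H\<rbrakk> \<Longrightarrow> hplus H a b = hplus H b a"
    and plus_zero: "a \<in> carrier H \<Longrightarrow> hplus H a (hzero H) = a"
    and diff_self: "a \<in> carrier H \<Longrightarrow> hdiff H a a = hzero H"
    and diff_diff: "\<lbrakk>a \<in> carrier H; b \<in> carrier H; c \<in> carrier H\<rbrakk>
      \<Longrightarrow> hdiff H (hdiff H a b) c = hdiff H a (hplus H b c)"
    and plus_diff: "\<lbrakk>a \<in> carrier H; b \<in> carrier H\<rbrakk>
      \<Longrightarrow> hplus H a (hdiff H b a) = hplus H b (hdiff H a b)"
    and cancel: "\<lbrakk>a \<in> carrier H; b \<in> carrier H\<rbrakk> \<Longrightarrow> hdiff H (hplus H a b) b = a"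

definition hoop_le :: "('a, 'b) hoop_scheme \<Rightarrow> 'a \<Rightarrow> 'a \<Rightarrow> bool" where
  "hoop_le H a b \<longleftrightarrow> hdiff H a b = hzero H"

text \<open>The greatest lower bound of two elements in a hoop.\<close>

definition hoop_meet :: "('a, 'b) hoop_scheme \<Rightarrow> 'a \<Rightarrow> 'a \<Rightarrow> 'a" where
  "hoop_meet H a b = hdiff H a (hdiff H a b)"

definition hoop_multiple :: "('a, 'b) hoop_scheme \<Rightarrow> nat \<Rightarrow> 'a \<Rightarrow> 'a" where
  "hoop_multiple H k a = (hplus H a ^^ k) (hzero H)"

definition hoop_strong_unit :: "('a, 'b) hoop_scheme \<Rightarrow> 'a \<Rightarrow> bool" where
  "hoop_strong_unit H u \<longleftrightarrow>
     u \<in> carrier H \<and> (\<forall>a\<in>carrier H. \<exists>k. hoop_le H a (hoop_multiple H k u))"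

definition hoop_endo :: "('a, 'b) hoop_scheme \<Rightarrow> ('a \<Rightarrow> 'a) \<Rightarrow> bool" where
  "hoop_endo H \<sigma> \<longleftrightarrow>
     \<sigma> \<in> carrier H \<rightarrow> carrier H \<and>
     \<sigma> (hzero H) = hzero H \<and>
     (\<forall>a\<in>carrier H. \<forall>b\<in>carrier H.
        \<sigma> (hplus H a b) = hplus H (\<sigma> a) (\<sigma> b) \<and>
        \<sigma> (hdiff H a b) = hdiff H (\<sigma> a) (\<sigma> b))"

definition hoop_ideal :: "('a, 'b) hoop_scheme \<Rightarrow> 'a set \<Rightarrow> bool" where
  "hoop_ideal H I \<longleftrightarrow>
     I \<subseteq> carrier H \<and> hzero H \<in> I \<and>
     (\<forall>a\<in>I. \<forall>b\<in>I. hplus H a b \<in> I) \<and>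
     (\<forall>a\<in>carrier H. \<forall>b\<in>I. hoop_le H a b \<longrightarrow> a \<in> I)"

definition hoop_prime_ideal :: "('a, 'b) hoop_scheme \<Rightarrow> 'a set \<Rightarrow> bool" where
  "hoop_prime_ideal H I \<longleftrightarrow>
     hoop_ideal H I \<and> I \<noteq> carrier H \<and>
     (\<forall>a\<in>carrier H. \<forall>b\<in>carrier H. hoop_meet H a b \<in> I \<longrightarrow> a \<in> I \<or> b \<in> I)"

definition hoop_max_spec :: "('a, 'b) hoop_scheme \<Rightarrow> 'a set set" where
  "hoop_max_spec H =
     {M. hoop_ideal H M \<and> M \<noteq> carrier H \<and>
         (\<forall>I. hoop_ideal H I \<and> M \<subseteq> I \<and> I \<noteq> carrier H \<longrightarrow> I = M)}"

definition hoop_nontrivial_endo :: "('a, 'b) hoop_scheme \<Rightarrow> ('a \<Rightarrow> 'a) \<Rightarrow> bool" where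
  "hoop_nontrivial_endo H \<sigma> \<longleftrightarrow>
     hoop_endo H \<sigma> \<and> \<not> (\<exists>I. hoop_prime_ideal H I \<and> \<sigma> ` carrier H \<subseteq> I)"

definition hoop_dual :: "('a, 'b) hoop_scheme \<Rightarrow> ('a \<Rightarrow> 'a) \<Rightarrow> 'a set \<Rightarrow> 'a set" where
  "hoop_dual H \<sigma> M = {a \<in> carrier H. \<sigma> a \<in> M}"

text \<open>The dimension \<open>n - 1 \<ge> 1\<close> is the cardinality of the finite index type \<open>'d\<close>.
  Functions on the unit cube are taken to be \<^const>\<open>undefined\<close> outside the cube, so that
  equality of functions is equality on the cube.\<close>

definition unit_cube :: "(real ^ 'd) set" where
  "unit_cube = {p. \<forall>i. 0 \<le> p $ i \<and> p $ i \<le> 1}"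

definition mcnaughton :: "(real ^ 'd \<Rightarrow> real) set" where
  "mcnaughton =
     {f \<in> extensional unit_cube. continuous_on unit_cube f \<and>
        (\<exists>P :: (('d \<Rightarrow> int) \<times> int) set. finite P \<and>
           (\<forall>p\<in>unit_cube. \<exists>(a, b)\<in>P.
              f p = (\<Sum>i\<in>UNIV. of_int (a i) * p $ i) + of_int b))}"

text \<open>The positive cone of the lattice-ordered group of all McNaughton functions.  It is the
  free cancellative hoop over \<open>CARD('d) + 1\<close> generators, freely generated by the
  functions \<open>coord i\<close> together with \<open>last_gen\<close> below.\<close>

definition mcn_hoop :: "(real ^ 'd \<Rightarrow> real) hoop" where
  "mcn_hoop =
     \<lparr> carrier = {f \<in> mcnaughton. \<forall>p\<in>unit_cube. 0 \<le> f p},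
       hplus = (\<lambda>f g. \<lambda>p\<in>unit_cube. f p + g p),
       hdiff = (\<lambda>f g. \<lambda>p\<in>unit_cube. max 0 (f p - g p)),
       hzero = (\<lambda>p\<in>unit_cube. 0) \<rparr>"

definition one_fun :: "real ^ 'd \<Rightarrow> real" where
  "one_fun = (\<lambda>p\<in>unit_cube. 1)"

definition coord :: "'d \<Rightarrow> real ^ 'd \<Rightarrow> real" where
  "coord i = (\<lambda>p\<in>unit_cube. p $ i)"

definition last_gen :: "real ^ 'd::finite \<Rightarrow> real" where
  "last_gen = (\<lambda>p\<in>unit_cube. 1 - Max (range (\<lambda>i. p $ i)))"

definition point_ideal :: "real ^ 'd \<Rightarrow> (real ^ 'd \<Rightarrow> real) set" where
  "point_ideal p = {f \<in> carrier mcn_hoop. f p = 0}"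

lemma mcnaughtonI:
  fixes f :: "real ^ 'd \<Rightarrow> real"
  assumes "f \<in> extensional unit_cube" "continuous_on unit_cube f" "finite P"
    and "\<And>p. p \<in> unit_cube \<Longrightarrow>
      \<exists>a b. (a, b) \<in> P \<and> f p = (\<Sum>i\<in>UNIV. of_int (a i) * p $ i) + of_int b"
  shows "f \<in> mcnaughton"
proof -
  have "\<forall>p\<in>unit_cube. \<exists>(a, b)\<in>P. f p = (\<Sum>i\<in>UNIV. of_int (a i) * p $ i) + of_int b"
    using assms(4) by (simp only: split_beta Bex_def split_paired_Ex fst_conv snd_conv Ball_def) simp
  then show ?thesis
    unfolding mcnaughton_def using assms(1-3) by (intro CollectI conjI exI[of _ P])
qed

lemma mcnaughtonE:
  fixes f :: "real ^ 'd \<Rightarrow> real"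
  assumes "f \<in> mcnaughton"
  obtains P where "finite P" and "\<And>p. p \<in> unit_cube \<Longrightarrow>
      \<exists>a b. (a, b) \<in> P \<and> f p = (\<Sum>i\<in>UNIV. of_int (a i) * p $ i) + of_int b"
proof -
  from assms obtain P where P: "finite P"
    "\<forall>p\<in>unit_cube. \<exists>(a, b)\<in>P. f p = (\<Sum>i\<in>UNIV. of_int (a i) * p $ i) + of_int b"
    unfolding mcnaughton_def by (elim CollectE conjE exE)
  have "\<exists>a b. (a, b) \<in> P \<and> f p = (\<Sum>i\<in>UNIV. of_int (a i) * p $ i) + of_int b"
    if "p \<in> unit_cube" for p
    using bspec[OF P(2) that] by (elim bexE) (simp only: split_beta, metis prod.collapse)
  with P(1) show thesis by (rule that)
qed

lemma mcnaughton_cont: "f \<in> mcnaughton \<Longrightarrow> continuous_on unit_cube f"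
  by (simp add: mcnaughton_def)

lemma mcnaughton_ext: "f \<in> mcnaughton \<Longrightarrow> f \<in> extensional unit_cube"
  by (simp add: mcnaughton_def)

lemma mcnaughton_affine:
  fixes a :: "'d::finite \<Rightarrow> int"
  shows "(\<lambda>p\<in>unit_cube. (\<Sum>i\<in>UNIV. of_int (a i) * p $ i) + of_int b) \<in> mcnaughton"
proof (rule mcnaughtonI[where P = "{(a, b)}"])
  have "continuous_on unit_cube (\<lambda>p. (\<Sum>i\<in>UNIV. of_int (a i) * p $ i) + real_of_int b)"
    by (intro continuous_intros)
  then show "continuous_on unit_cube
      (\<lambda>p\<in>unit_cube. (\<Sum>i\<in>UNIV. of_int (a i) * p $ i) + real_of_int b)"
    by (rule continuous_on_eq) simp
qed auto

lemma mcnaughton_add: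
  fixes f g :: "real ^ 'd::finite \<Rightarrow> real"
  assumes f: "f \<in> mcnaughton" and g: "g \<in> mcnaughton"
  shows "(\<lambda>p\<in>unit_cube. f p + g p) \<in> mcnaughton"
proof -
  obtain P where P: "finite P" "\<And>p. p \<in> unit_cube \<Longrightarrow>
      \<exists>a b. (a, b) \<in> P \<and> f p = (\<Sum>i\<in>UNIV. of_int (a i) * p $ i) + of_int b"
    using mcnaughtonE[OF f] by blast
  obtain Q where Q: "finite Q" "\<And>p. p \<in> unit_cube \<Longrightarrow>
      \<exists>a b. (a, b) \<in> Q \<and> g p = (\<Sum>i\<in>UNIV. of_int (a i) * p $ i) + of_int b"
    using mcnaughtonE[OF g] by blast
  let ?R = "(\<lambda>((a, b), (a', b')). (\<lambda>i. a i + a' i, b + b')) ` (P \<times> Q)"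
  show ?thesis
  proof (rule mcnaughtonI[where P = ?R])
    have "continuous_on unit_cube (\<lambda>p. f p + g p)"
      using f g by (intro continuous_intros mcnaughton_cont)
    then show "continuous_on unit_cube (\<lambda>p\<in>unit_cube. f p + g p)"
      by (rule continuous_on_eq) simp
    show "finite ?R" using P(1) Q(1) by simp
  next
    fix p :: "real ^ 'd" assume p: "p \<in> unit_cube"
    obtain a b where ab: "(a, b) \<in> P" "f p = (\<Sum>i\<in>UNIV. of_int (a i) * p $ i) + of_int b"
      using P(2)[OF p] by blast
    obtain a' b' where ab': "(a', b') \<in> Q" "g p = (\<Sum>i\<in>UNIV. of_int (a' i) * p $ i) + of_int b'"
      using Q(2)[OF p] by blast
    have "(\<lambda>i. a i + a' i, b + b') \<in> ?R"
      using ab(1) ab'(1) by (intro image_eqI[where x = "((a, b), (a', b'))"]) simp_all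
    moreover have "(\<lambda>p\<in>unit_cube. f p + g p) p
        = (\<Sum>i\<in>UNIV. of_int (a i + a' i) * p $ i) + of_int (b + b')"
      using p ab(2) ab'(2) by (simp add: algebra_simps sum.distrib)
    ultimately show "\<exists>a b. (a, b) \<in> ?R \<and> (\<lambda>p\<in>unit_cube. f p + g p) p
        = (\<Sum>i\<in>UNIV. of_int (a i) * p $ i) + of_int b"
      by blast
  qed simp
qed

lemma mcnaughton_neg:
  fixes f :: "real ^ 'd::finite \<Rightarrow> real"
  assumes f: "f \<in> mcnaughton"
  shows "(\<lambda>p\<in>unit_cube. - f p) \<in> mcnaughton"
proof -
  obtain P where P: "finite P" "\<And>p. p \<in> unit_cube \<Longrightarrow>
      \<exists>a b. (a, b) \<in> P \<and> f p = (\<Sum>i\<in>UNIV. of_int (a i) * p $ i) + of_int b"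
    using mcnaughtonE[OF f] by blast
  let ?R = "(\<lambda>(a, b). (\<lambda>i. - a i, - b)) ` P"
  show ?thesis
  proof (rule mcnaughtonI[where P = ?R])
    have "continuous_on unit_cube (\<lambda>p. - f p)"
      using f by (intro continuous_intros mcnaughton_cont)
    then show "continuous_on unit_cube (\<lambda>p\<in>unit_cube. - f p)"
      by (rule continuous_on_eq) simp
    show "finite ?R" using P(1) by simp
  next
    fix p :: "real ^ 'd" assume p: "p \<in> unit_cube"
    obtain a b where ab: "(a, b) \<in> P" "f p = (\<Sum>i\<in>UNIV. of_int (a i) * p $ i) + of_int b"
      using P(2)[OF p] by blast
    have "(\<lambda>i. - a i, - b) \<in> ?R"
      using ab(1) by (intro image_eqI[where x = "(a, b)"]) simp_all
    moreover have "(\<lambda>p\<in>unit_cube. - f p) p = (\<Sum>i\<in>UNIV. of_int (- a i) * p $ i) + of_int (- b)"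
      using p ab(2) by (simp add: sum_negf)
    ultimately show "\<exists>a b. (a, b) \<in> ?R \<and> (\<lambda>p\<in>unit_cube. - f p) p
        = (\<Sum>i\<in>UNIV. of_int (a i) * p $ i) + of_int b"
      by blast
  qed simp
qed

lemma mcnaughton_max:
  fixes f g :: "real ^ 'd::finite \<Rightarrow> real"
  assumes f: "f \<in> mcnaughton" and g: "g \<in> mcnaughton"
  shows "(\<lambda>p\<in>unit_cube. max (f p) (g p)) \<in> mcnaughton"
proof -
  obtain P where P: "finite P" "\<And>p. p \<in> unit_cube \<Longrightarrow>
      \<exists>a b. (a, b) \<in> P \<and> f p = (\<Sum>i\<in>UNIV. of_int (a i) * p $ i) + of_int b"
    using mcnaughtonE[OF f] by blast
  obtain Q where Q: "finite Q" "\<And>p. p \<in> unit_cube \<Longrightarrow>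
      \<exists>a b. (a, b) \<in> Q \<and> g p = (\<Sum>i\<in>UNIV. of_int (a i) * p $ i) + of_int b"
    using mcnaughtonE[OF g] by blast
  show ?thesis
  proof (rule mcnaughtonI[where P = "P \<union> Q"])
    have "continuous_on unit_cube (\<lambda>p. max (f p) (g p))"
      using f g by (intro continuous_intros mcnaughton_cont)
    then show "continuous_on unit_cube (\<lambda>p\<in>unit_cube. max (f p) (g p))"
      by (rule continuous_on_eq) simp
    show "finite (P \<union> Q)" using P(1) Q(1) by simp
  next
    fix p :: "real ^ 'd" assume p: "p \<in> unit_cube"
    have "(\<lambda>p\<in>unit_cube. max (f p) (g p)) p = f p \<or> (\<lambda>p\<in>unit_cube. max (f p) (g p)) p = g p"
      using p by (simp add: max_def)
    then show "\<exists>a b. (a, b) \<in> P \<union> Q \<and> (\<lambda>p\<in>unit_cube. max (f p) (g p)) p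
        = (\<Sum>i\<in>UNIV. of_int (a i) * p $ i) + of_int b"
      using P(2)[OF p] Q(2)[OF p] by (metis UnI1 UnI2)
  qed simp
qed

lemma mcnaughton_const:
  "(\<lambda>p\<in>unit_cube. of_int b) \<in> (mcnaughton :: (real ^ 'd::finite \<Rightarrow> real) set)"
  using mcnaughton_affine[of "\<lambda>_. 0" b] by simp

lemma mcn_hoop_simps [simp]:
  "carrier mcn_hoop = {f \<in> mcnaughton. \<forall>p\<in>unit_cube. 0 \<le> f p}"
  "hplus mcn_hoop = (\<lambda>f g. \<lambda>p\<in>unit_cube. f p + g p)"
  "hdiff mcn_hoop = (\<lambda>f g. \<lambda>p\<in>unit_cube. max 0 (f p - g p))"
  "hzero mcn_hoop = (\<lambda>p\<in>unit_cube. 0)"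
  by (simp_all add: mcn_hoop_def)

theorem mcn_hoop_cancellative:
  "cancellative_hoop (mcn_hoop :: (real ^ 'd::finite \<Rightarrow> real) hoop)"
proof
  let ?H = "mcn_hoop :: (real ^ 'd \<Rightarrow> real) hoop"
  show "hzero ?H \<in> carrier ?H"
    using mcnaughton_const[of 0] by simp
  fix f g h assume f: "f \<in> carrier ?H"
  have undef: "f p = undefined" if "p \<notin> unit_cube" for p
    using f that mcnaughton_ext[of f] by (simp add: extensional_def)
  show "hplus ?H f (hzero ?H) = f"
    using undef by (simp add: fun_eq_iff restrict_def)
  show "hdiff ?H f f = hzero ?H"
    by (simp add: fun_eq_iff restrict_def)
  assume g: "g \<in> carrier ?H"
  show "hplus ?H f g \<in> carrier ?H"
    using f g mcnaughton_add[of f g] by simp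
  have "(\<lambda>p\<in>unit_cube. f p + (\<lambda>p\<in>unit_cube. - g p) p) \<in> mcnaughton"
    using mcnaughton_add[of f "\<lambda>p\<in>unit_cube. - g p"] mcnaughton_neg[of g] f g by simp
  from mcnaughton_max[OF mcnaughton_const[of 0] this]
  have "(\<lambda>p\<in>unit_cube. max 0 (f p - g p)) \<in> mcnaughton"
    by (rule back_subst[where P = "\<lambda>h. h \<in> mcnaughton"]) (simp add: fun_eq_iff restrict_def)
  then show "hdiff ?H f g \<in> carrier ?H"
    by simp
  show "hplus ?H f g = hplus ?H g f"
    by (simp add: add.commute)
  show "hplus ?H f (hdiff ?H g f) = hplus ?H g (hdiff ?H f g)"
    by (simp add: fun_eq_iff restrict_def max_def)
  show "hdiff ?H (hplus ?H f g) g = f"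
    using f undef by (simp add: fun_eq_iff restrict_def)
  assume h: "h \<in> carrier ?H"
  show "hplus ?H (hplus ?H f g) h = hplus ?H f (hplus ?H g h)"
    by (simp add: fun_eq_iff restrict_def)
  have "max 0 (max 0 (f p - g p) - h p) = max 0 (f p - (g p + h p))" if "p \<in> unit_cube" for p
    using h that by (auto simp: max_def)
  then show "hdiff ?H (hdiff ?H f g) h = hdiff ?H f (hplus ?H g h)"
    by (simp add: fun_eq_iff restrict_def)
qed

end

theory Submission
  imports Defs
begin

text \<open>For a point \<open>p\<close> of the cube, evaluating \<open>\<sigma> h\<close> at \<open>p\<close> is a real-valued hoop homomorphism
  \<open>\<phi>\<close> with \<open>\<phi> \<one> > 0\<close>. Its kernel is a proper ideal, so by compactness of the cube all its elements
  vanish at a common point \<open>q\<close>. If \<open>h q < m / k\<close>, then the truncated difference of \<open>m \<one>\<close> and \<open>k h\<close>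
  does not vanish at \<open>q\<close>, so it is not in the kernel, that is, \<open>k \<phi> h < m \<phi> \<one>\<close>; the reversed
  inequalities are treated alike. Hence \<open>\<phi> h = \<phi> \<one> * h q\<close> for all \<open>h\<close>, as in
  Hoelder's theorem, and the coordinate functions \<open>h\<close> show that \<open>q = S p\<close>. This avoids
  the theorem that the McNaughton functions are generated by the coordinate projections.\<close>

section \<open>Preliminaries on the cube and on rational approximation\<close>

lemma compact_unit_cube: "compact (unit_cube :: (real ^ 'd::finite) set)"
proof -
  have "unit_cube = cbox (0 :: real ^ 'd) 1"
    by (auto simp: unit_cube_def mem_box_cart)
  then show ?thesis by (metis compact_cbox)
qed

text \<open>Density of the rationals with the denominators cleared: \<open>m / k\<close> separates
  \<open>x\<close> from \<open>y\<close>. In this form the inequalities compare natural multiples,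
  which a hoop can express.\<close>

lemma ex_nat_fraction_between:
  fixes x y :: real
  assumes "0 \<le> x" "x < y"
  obtains m k :: nat where "k > 0" "real k * x < real m" "real m < real k * y"
proof -
  obtain r where r: "r \<in> \<rat>" "x < r" "r < y"
    using Rats_dense_in_real[OF \<open>x < y\<close>] by blast
  obtain m k :: nat where "k \<noteq> 0" "\<bar>r\<bar> = real m / real k"
    using Rats_abs_nat_div_natE[OF r(1)] by metis
  with r assms(1) have "k > 0" "real m = real k * r"
    by (auto simp: field_simps)
  with r show thesis
    by (intro that[of k m]) auto
qed


section \<open>The hoop of McNaughton functions\<close>

lemma hoop_le_mcn:
  "hoop_le mcn_hoop f g \<longleftrightarrow> (\<forall>p\<in>unit_cube. f p \<le> g p)"
  by (auto simp: hoop_le_def fun_eq_iff restrict_def max_def) (metis linorder_le_cases)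

lemma hoop_multiple_mcn_apply:
  "p \<in> unit_cube \<Longrightarrow> hoop_multiple mcn_hoop k f p = real k * f p"
  by (induction k) (simp_all add: hoop_multiple_def algebra_simps)

lemma mcn_zero_closed: "hzero mcn_hoop \<in> carrier (mcn_hoop :: (real ^ 'd::finite \<Rightarrow> real) hoop)"
  using mcnaughton_const[of 0] by simp

lemma mcn_plus_closed:
  fixes a b :: "real ^ 'd::finite \<Rightarrow> real"
  shows "a \<in> carrier mcn_hoop \<Longrightarrow> b \<in> carrier mcn_hoop \<Longrightarrow> hplus mcn_hoop a b \<in> carrier mcn_hoop"
  by (simp add: mcnaughton_add)

text \<open>The union of the finite families of affine pieces of the members of \<open>A\<close>
  serves as a family for \<open>h\<close>. This covers functions built by pointwise maxima, such as
  truncated differences and \<open>last_gen\<close>.\<close>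

lemma mcnaughton_selection:
  fixes h :: "real ^ 'd::finite \<Rightarrow> real"
  assumes "h \<in> extensional unit_cube" "continuous_on unit_cube h" and "finite A" "A \<subseteq> mcnaughton"
    and sel: "\<And>p. p \<in> unit_cube \<Longrightarrow> \<exists>g\<in>A. h p = g p"
  shows "h \<in> mcnaughton"
proof -
  have "\<forall>g\<in>A. \<exists>P. finite P \<and> (\<forall>p\<in>unit_cube. \<exists>a b. (a, b) \<in> P \<and>
      g p = (\<Sum>i\<in>UNIV. of_int (a i) * p $ i) + of_int b)"
  proof
    fix g assume "g \<in> A"
    then have "g \<in> mcnaughton" using \<open>A \<subseteq> mcnaughton\<close> by blast
    then show "\<exists>P. finite P \<and> (\<forall>p\<in>unit_cube. \<exists>a b. (a, b) \<in> P \<and>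
        g p = (\<Sum>i\<in>UNIV. of_int (a i) * p $ i) + of_int b)"
      by (rule mcnaughtonE) blast
  qed
  then obtain P where P: "\<forall>g\<in>A. finite (P g) \<and> (\<forall>p\<in>unit_cube. \<exists>a b. (a, b) \<in> P g \<and>
      g p = (\<Sum>i\<in>UNIV. of_int (a i) * p $ i) + of_int b)"
    by (rule bchoice[THEN exE])
  show ?thesis
  proof (rule mcnaughtonI[where P = "\<Union>g\<in>A. P g"])
    fix p :: "real ^ 'd"
    assume p: "p \<in> unit_cube"
    then obtain g where "g \<in> A" "h p = g p" using sel by blast
    with P p show "\<exists>a b. (a, b) \<in> (\<Union>g\<in>A. P g) \<and> h p = (\<Sum>i\<in>UNIV. of_int (a i) * p $ i) + of_int b"
      by fastforce
  qed (use assms P in auto)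
qed

lemma mcnaughton_diff:
  fixes f g :: "real ^ 'd::finite \<Rightarrow> real"
  assumes "f \<in> mcnaughton" "g \<in> mcnaughton"
  shows "(\<lambda>p\<in>unit_cube. f p - g p) \<in> mcnaughton"
proof -
  have "(\<lambda>p\<in>unit_cube. f p - g p) = (\<lambda>p\<in>unit_cube. f p + (\<lambda>p\<in>unit_cube. - g p) p)"
    by (simp add: fun_eq_iff restrict_def)
  with mcnaughton_add[OF assms(1) mcnaughton_neg[OF assms(2)]] show ?thesis
    by (simp only:)
qed

lemma mcn_diff_closed:
  fixes a b :: "real ^ 'd::finite \<Rightarrow> real"
  assumes a: "a \<in> carrier mcn_hoop" and b: "b \<in> carrier mcn_hoop"
  shows "hdiff mcn_hoop a b \<in> carrier mcn_hoop"
proof -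
  have "(\<lambda>p\<in>unit_cube. max 0 (a p - b p)) \<in> mcnaughton"
  proof (rule mcnaughton_selection)
    have "continuous_on unit_cube (\<lambda>p. max 0 (a p - b p))"
      using a b by (intro continuous_intros mcnaughton_cont) auto
    then show "continuous_on unit_cube (\<lambda>p\<in>unit_cube. max 0 (a p - b p))"
      by (rule continuous_on_eq) simp
    show "{\<lambda>p\<in>unit_cube. 0, \<lambda>p\<in>unit_cube. a p - b p} \<subseteq> mcnaughton"
      using mcn_zero_closed[where 'd = 'd] mcnaughton_diff[of a b] a b by simp
  qed (auto simp: max_def)
  then show ?thesis by simp
qed

lemma mcn_multiple_closed:
  fixes a :: "real ^ 'd::finite \<Rightarrow> real"
  shows "a \<in> carrier mcn_hoop \<Longrightarrow> hoop_multiple mcn_hoop k a \<in> carrier mcn_hoop"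
  by (induction k)
    (simp_all add: hoop_multiple_def mcn_zero_closed mcn_plus_closed del: mcn_hoop_simps)

lemma one_fun_carrier: "one_fun \<in> carrier (mcn_hoop :: (real ^ 'd::finite \<Rightarrow> real) hoop)"
  using mcnaughton_const[of 1] by (simp add: one_fun_def)

lemma coord_carrier: "coord i \<in> carrier (mcn_hoop :: (real ^ 'd::finite \<Rightarrow> real) hoop)"
proof -
  have "(\<Sum>j\<in>UNIV. of_int (if j = i then 1 else 0) * p $ j) = p $ i" for p :: "real ^ 'd"
    by (simp add: if_distrib if_distribR cong: if_cong)
  with mcnaughton_affine[of "\<lambda>j. if j = i then 1 else 0" 0] show ?thesis
    by (simp add: coord_def unit_cube_def)
qed

lemma continuous_on_Max:
  fixes g :: "'i \<Rightarrow> 'a::topological_space \<Rightarrow> real"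
  assumes "finite A" "A \<noteq> {}" "\<And>i. i \<in> A \<Longrightarrow> continuous_on X (g i)"
  shows "continuous_on X (\<lambda>x. Max ((\<lambda>i. g i x) ` A))"
  using assms by (induction A rule: finite_ne_induct) (simp_all add: continuous_on_max)

lemma last_gen_carrier: "last_gen \<in> carrier (mcn_hoop :: (real ^ 'd::finite \<Rightarrow> real) hoop)"
proof -
  have "last_gen \<in> (mcnaughton :: (real ^ 'd \<Rightarrow> real) set)"
  proof (rule mcnaughton_selection)
    show "last_gen \<in> extensional unit_cube"
      by (simp add: last_gen_def)
    have "continuous_on unit_cube (\<lambda>p :: real ^ 'd. 1 - Max (range (\<lambda>i. p $ i)))"
      by (intro continuous_intros continuous_on_Max) auto
    then show "continuous_on unit_cube (last_gen :: real ^ 'd \<Rightarrow> real)"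
      unfolding last_gen_def by (rule continuous_on_eq) simp
    \<comment> \<open>At each point \<open>last_gen\<close> agrees with \<one> - x_i for an index i
      at which the maximum is attained.\<close>
    show "range (\<lambda>i. \<lambda>p\<in>unit_cube. one_fun p - coord i p) \<subseteq> (mcnaughton :: (real ^ 'd \<Rightarrow> real) set)"
      using one_fun_carrier[where 'd = 'd] coord_carrier[where 'd = 'd]
      by (auto intro!: mcnaughton_diff)
  next
    fix p :: "real ^ 'd"
    assume p: "p \<in> unit_cube"
    have "Max (range (\<lambda>i. p $ i)) \<in> range (\<lambda>i. p $ i)"
      by (intro Max_in) auto
    then obtain i where "Max (range (\<lambda>i. p $ i)) = p $ i" by (rule rangeE)
    with p show "\<exists>g\<in>range (\<lambda>i. \<lambda>p\<in>unit_cube. one_fun p - coord i p). last_gen p = g p"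
      by (auto simp: last_gen_def one_fun_def coord_def)
  qed simp
  moreover have "0 \<le> last_gen p" if "p \<in> unit_cube" for p :: "real ^ 'd"
    using that by (auto simp: last_gen_def unit_cube_def)
  ultimately show ?thesis by simp
qed

text \<open>The quotient \<open>h / u\<close> is continuous on the compact cube, hence bounded, and
  any natural number above the bound is a suitable multiplier.\<close>

lemma mcn_strong_unitI:
  fixes u :: "real ^ 'd::finite \<Rightarrow> real"
  assumes u: "u \<in> carrier mcn_hoop" and pos: "\<And>p. p \<in> unit_cube \<Longrightarrow> u p \<noteq> 0"
  shows "hoop_strong_unit mcn_hoop u"
  unfolding hoop_strong_unit_def hoop_le_mcn
proof (intro conjI ballI u)
  fix h :: "real ^ 'd \<Rightarrow> real"
  assume h: "h \<in> carrier mcn_hoop"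
  have "continuous_on unit_cube (\<lambda>p. h p / u p)"
    using u h pos by (intro continuous_on_divide mcnaughton_cont) auto
  then have "bounded ((\<lambda>p. h p / u p) ` unit_cube)"
    by (intro compact_imp_bounded compact_continuous_image compact_unit_cube)
  then obtain B where B: "\<And>p. p \<in> unit_cube \<Longrightarrow> \<bar>h p / u p\<bar> \<le> B"
    by (auto simp: bounded_iff)
  obtain k :: nat where "B \<le> real k"
    using real_arch_simple by blast
  have "h p \<le> real k * u p" if "p \<in> unit_cube" for p
  proof -
    have "u p > 0" using u pos[OF that] that by (simp add: less_le)
    moreover have "h p / u p \<le> real k" using B[OF that] \<open>B \<le> real k\<close> by linarith
    ultimately show ?thesis by (simp add: field_simps)
  qed
  then show "\<exists>k. \<forall>p\<in>unit_cube. h p \<le> hoop_multiple mcn_hoop k u p"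
    by (auto simp: hoop_multiple_mcn_apply)
qed


section \<open>Maximal ideals and points\<close>

text \<open>Evaluation at \<open>p\<close> turns the meet into the minimum of two nonnegative reals,
  which is zero only if one of them is. The function \<open>one_fun\<close> witnesses
  properness.\<close>

lemma point_ideal_prime:
  assumes "p \<in> unit_cube"
  shows "hoop_prime_ideal mcn_hoop (point_ideal p :: (real ^ 'd::finite \<Rightarrow> real) set)"
proof -
  have "one_fun \<notin> point_ideal p"
    using assms by (simp add: point_ideal_def one_fun_def)
  then have "point_ideal p \<noteq> carrier mcn_hoop"
    using one_fun_carrier by metis
  moreover have "hoop_ideal mcn_hoop (point_ideal p)"
    unfolding hoop_ideal_def hoop_le_mcn
  proof (intro conjI ballI impI)
    show "hzero mcn_hoop \<in> point_ideal p"
      using mcn_zero_closed[where 'd = 'd] assms by (simp add: point_ideal_def)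
  next
    fix a b :: "real ^ 'd \<Rightarrow> real" assume "a \<in> point_ideal p" "b \<in> point_ideal p"
    then show "hplus mcn_hoop a b \<in> point_ideal p"
      using mcn_plus_closed[of a b] assms by (simp add: point_ideal_def)
  next
    fix a b :: "real ^ 'd \<Rightarrow> real"
    assume "a \<in> carrier mcn_hoop" "b \<in> point_ideal p" "\<forall>p\<in>unit_cube. a p \<le> b p"
    then show "a \<in> point_ideal p"
      using assms by (force simp: point_ideal_def)
  qed (auto simp: point_ideal_def)
  moreover have "a \<in> point_ideal p \<or> b \<in> point_ideal p"
    if "a \<in> carrier mcn_hoop" "b \<in> carrier mcn_hoop" "hoop_meet mcn_hoop a b \<in> point_ideal p" for a b
    using that assms by (auto simp: point_ideal_def hoop_meet_def max_def split: if_splits)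
  ultimately show ?thesis
    by (auto simp only: hoop_prime_ideal_def)
qed

text \<open>An element without zeros is a strong unit; its multiples stay in the ideal and dominate
  every function, so the ideal would be the whole hoop.\<close>

lemma proper_ideal_imp_zero:
  fixes u :: "real ^ 'd::finite \<Rightarrow> real"
  assumes I: "hoop_ideal mcn_hoop I" "I \<noteq> carrier mcn_hoop" and u: "u \<in> I"
  shows "\<exists>p\<in>unit_cube. u p = 0"
proof (rule ccontr)
  assume "\<not> ?thesis"
  with u I(1) have unit: "hoop_strong_unit mcn_hoop u"
    by (intro mcn_strong_unitI) (auto simp: hoop_ideal_def)
  have "hoop_multiple mcn_hoop k u \<in> I" for k
    using I(1) u by (induction k) (auto simp: hoop_multiple_def hoop_ideal_def simp del: mcn_hoop_simps)
  with unit I(1) have "carrier mcn_hoop \<subseteq> I"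
    unfolding hoop_strong_unit_def hoop_ideal_def by blast
  with I show False
    by (auto simp only: hoop_ideal_def)
qed

text \<open>All functions are nonnegative, so the sum of the members of \<open>F\<close> is such a
  bound. It reduces common zeros of finitely many elements to zeros of one.\<close>

lemma ideal_finite_upper_bound:
  assumes I: "hoop_ideal mcn_hoop I" and "finite F" "F \<subseteq> I"
  shows "\<exists>u\<in>I. \<forall>h\<in>F. \<forall>p\<in>unit_cube. h p \<le> u p"
  using assms(2,3)
proof (induction F rule: finite_induct)
  case empty
  then show ?case using I by (auto simp only: hoop_ideal_def)
next
  case (insert g F)
  then obtain u where u: "u \<in> I" "\<And>h p. h \<in> F \<Longrightarrow> p \<in> unit_cube \<Longrightarrow> h p \<le> u p"
    by auto
  have "hplus mcn_hoop g u \<in> I"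
    using I u(1) insert.prems by (auto simp only: hoop_ideal_def)
  moreover have "h p \<le> hplus mcn_hoop g u p" if "h \<in> insert g F" "p \<in> unit_cube" for h p
  proof -
    have "0 \<le> g p" "0 \<le> u p"
      using I insert.prems u(1) that(2) by (auto simp: hoop_ideal_def)
    then show ?thesis using that u(2)[of h p] by auto
  qed
  ultimately show ?case by blast
qed

lemma proper_ideal_subset_point_ideal:
  fixes I :: "(real ^ 'd::finite \<Rightarrow> real) set"
  assumes I: "hoop_ideal mcn_hoop I" "I \<noteq> carrier mcn_hoop"
  obtains q where "q \<in> unit_cube" "I \<subseteq> point_ideal q"
proof -
  have sub: "I \<subseteq> carrier mcn_hoop"
    using I(1) by (simp only: hoop_ideal_def)
  let ?Z = "\<lambda>h. {p \<in> unit_cube. h p = 0} :: (real ^ 'd) set"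
  have "unit_cube \<inter> \<Inter> (?Z ` I) \<noteq> {}"
  proof (rule compact_imp_fip_image[OF compact_unit_cube])
    fix h assume "h \<in> I"
    then have "continuous_on unit_cube h"
      using sub by (auto intro: mcnaughton_cont)
    then show "closed (?Z h)"
      using continuous_closed_preimage_constant compact_imp_closed[OF compact_unit_cube] by blast
  next
    fix F assume F: "finite F" "F \<subseteq> I"
    \<comment> \<open>Finite intersection property: a zero of a bound \<open>u\<close> of
      \<open>F\<close> inside the ideal is a zero of every \<open>h\<close> in \<open>F\<close>,
      since 0 \<le> h \<le> u.\<close>
    obtain u where u: "u \<in> I" "\<And>h p. h \<in> F \<Longrightarrow> p \<in> unit_cube \<Longrightarrow> h p \<le> u p"
      using ideal_finite_upper_bound[OF I(1) F] by blast
    obtain p where p: "p \<in> unit_cube" "u p = 0"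
      using proper_ideal_imp_zero[OF I u(1)] by blast
    have "h p = 0" if "h \<in> F" for h
    proof -
      have "0 \<le> h p" using that F(2) sub p(1) by auto
      then show ?thesis using u(2)[OF that p(1)] p(2) by simp
    qed
    with p(1) show "unit_cube \<inter> \<Inter> (?Z ` F) \<noteq> {}" by blast
  qed
  then obtain q where "q \<in> unit_cube" "\<And>h. h \<in> I \<Longrightarrow> h q = 0"
    by blast
  with sub show thesis
    by (intro that[of q]) (auto simp only: point_ideal_def)
qed

text \<open>If the points differ in coordinate i, a rational \<open>m / k\<close> strictly between
  the two values yields a truncated difference of \<open>k\<close> x_i and \<open>m\<close> \<one>,
  in one order or the other, that vanishes at \<open>p\<close> but not at \<open>q\<close>.\<close>

lemma point_ideal_subset_imp_eq:
  fixes p q :: "real ^ 'd::finite"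
  assumes p: "p \<in> unit_cube" and q: "q \<in> unit_cube" and sub: "point_ideal p \<subseteq> point_ideal q"
  shows "p = q"
proof (rule ccontr)
  have vanish: "hdiff mcn_hoop a b q = 0"
    if "a \<in> carrier mcn_hoop" "b \<in> carrier mcn_hoop" "a p \<le> b p" for a b
    using mcn_diff_closed[OF that(1,2)] sub that(3) p by (auto simp: point_ideal_def)
  assume "p \<noteq> q"
  then obtain i where "p $ i \<noteq> q $ i" by (auto simp: vec_eq_iff)
  then consider "p $ i < q $ i" | "q $ i < p $ i" by linarith
  then show False
  proof cases
    case 1
    have "0 \<le> p $ i" using p by (simp add: unit_cube_def)
    from this 1 obtain m k :: nat
      where "k > 0" "real k * p $ i < real m" "real m < real k * q $ i"
      by (rule ex_nat_fraction_between)
    with vanish[OF mcn_multiple_closed[OF coord_carrier]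
        mcn_multiple_closed[OF one_fun_carrier], of k i m]
    show False
      using p q by (simp add: hoop_multiple_mcn_apply coord_def one_fun_def)
  next
    case 2
    have "0 \<le> q $ i" using q by (simp add: unit_cube_def)
    from this 2 obtain m k :: nat
      where "k > 0" "real k * q $ i < real m" "real m < real k * p $ i"
      by (rule ex_nat_fraction_between)
    with vanish[OF mcn_multiple_closed[OF one_fun_carrier]
        mcn_multiple_closed[OF coord_carrier], of m k i]
    show False
      using p q by (simp add: hoop_multiple_mcn_apply coord_def one_fun_def)
  qed
qed

text \<open>Every proper ideal lies in a point ideal, and distinct point ideals are incomparable;
  hence the point ideals are exactly the maximal ones, each from a single point.\<close>

theorem bij_betw_point_ideal_max_spec:
  "bij_betw point_ideal (unit_cube :: (real ^ 'd::finite) set) (hoop_max_spec mcn_hoop)"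
proof -
  have proper: "hoop_ideal mcn_hoop (point_ideal p)" "point_ideal p \<noteq> carrier mcn_hoop"
    if "p \<in> unit_cube" for p :: "real ^ 'd"
    using point_ideal_prime[OF that] by (auto simp only: hoop_prime_ideal_def)
  have "point_ideal p \<in> hoop_max_spec mcn_hoop" if p: "p \<in> unit_cube" for p :: "real ^ 'd"
  proof -
    have "I = point_ideal p"
      if I: "hoop_ideal mcn_hoop I" "I \<noteq> carrier mcn_hoop" "point_ideal p \<subseteq> I" for I
    proof -
      obtain q where q: "q \<in> unit_cube" "I \<subseteq> point_ideal q"
        using proper_ideal_subset_point_ideal[OF I(1,2)] by blast
      with I(3) have "p = q"
        by (intro point_ideal_subset_imp_eq[OF p]) auto
      with I(3) q(2) show ?thesis by blast
    qed
    with proper[OF p] show ?thesis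
      unfolding hoop_max_spec_def by blast
  qed
  moreover have "\<exists>p\<in>unit_cube. M = point_ideal p"
    if M: "M \<in> hoop_max_spec mcn_hoop" for M :: "(real ^ 'd \<Rightarrow> real) set"
  proof -
    obtain p where "p \<in> unit_cube" "M \<subseteq> point_ideal p"
      using M proper_ideal_subset_point_ideal[of M] unfolding hoop_max_spec_def by blast
    with M proper[of p] show ?thesis
      unfolding hoop_max_spec_def by blast
  qed
  ultimately show ?thesis
    unfolding bij_betw_def inj_on_def by (blast intro: point_ideal_subset_imp_eq)
qed


section \<open>Real-valued homomorphisms are scaled point evaluations\<close>

lemma mcn_functional_is_evaluation:
  fixes \<phi> :: "(real ^ 'd::finite \<Rightarrow> real) \<Rightarrow> real"
  assumes nonneg: "\<And>a. a \<in> carrier mcn_hoop \<Longrightarrow> 0 \<le> \<phi> a"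
    and add: "\<And>a b. a \<in> carrier mcn_hoop \<Longrightarrow> b \<in> carrier mcn_hoop \<Longrightarrow>
      \<phi> (hplus mcn_hoop a b) = \<phi> a + \<phi> b"
    and diff: "\<And>a b. a \<in> carrier mcn_hoop \<Longrightarrow> b \<in> carrier mcn_hoop \<Longrightarrow>
      \<phi> (hdiff mcn_hoop a b) = max 0 (\<phi> a - \<phi> b)"
    and unit: "\<phi> one_fun \<noteq> 0"
  obtains q where "q \<in> unit_cube" "\<And>h. h \<in> carrier mcn_hoop \<Longrightarrow> \<phi> h = \<phi> one_fun * h q"
proof -
  let ?H = "mcn_hoop :: (real ^ 'd \<Rightarrow> real) hoop"
  \<comment> \<open>Additivity is applied to 0 + 0 = 0.\<close>
  have zero: "\<phi> (hzero ?H) = 0"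
    using add[OF mcn_zero_closed mcn_zero_closed] by (simp add: restrict_def cong: if_cong)
  \<comment> \<open>The order is defined by the vanishing of the truncated difference, which
    \<open>\<phi>\<close> preserves.\<close>
  have mono: "\<phi> a \<le> \<phi> b" if "a \<in> carrier ?H" "b \<in> carrier ?H" "hoop_le ?H a b" for a b
    using diff[OF that(1,2)] that(3) zero by (simp add: hoop_le_def del: mcn_hoop_simps)
  have mul: "\<phi> (hoop_multiple ?H k a) = real k * \<phi> a" if "a \<in> carrier ?H" for k a
  proof (induction k)
    case 0
    show ?case by (simp add: hoop_multiple_def zero del: mcn_hoop_simps)
  next
    case (Suc k)
    have "hoop_multiple ?H (Suc k) a = hplus ?H a (hoop_multiple ?H k a)"
      by (simp add: hoop_multiple_def del: mcn_hoop_simps)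
    with Suc add[OF that mcn_multiple_closed[OF that]] show ?case
      by (simp add: algebra_simps del: mcn_hoop_simps)
  qed
  define K where "K = {a \<in> carrier ?H. \<phi> a = 0}"
  have "hoop_ideal ?H K"
    unfolding hoop_ideal_def
  proof (intro conjI ballI impI)
    fix a b assume "a \<in> carrier ?H" "b \<in> K" "hoop_le ?H a b"
    then show "a \<in> K"
      using mono[of a b] nonneg[of a] unfolding K_def by (auto simp del: mcn_hoop_simps)
  qed (use zero mcn_zero_closed add mcn_plus_closed in \<open>auto simp: K_def simp del: mcn_hoop_simps\<close>)
  moreover have "K \<noteq> carrier ?H"
    using unit one_fun_carrier unfolding K_def by blast
  ultimately obtain q where q: "q \<in> unit_cube" "K \<subseteq> point_ideal q"
    by (rule proper_ideal_subset_point_ideal)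
  let ?c = "\<phi> one_fun"
  have c: "?c > 0"
    using unit nonneg[OF one_fun_carrier] by simp
  \<comment> \<open>Contrapositive: \<phi> a \<le> \<phi> b puts the truncated difference of
    \<open>a\<close> and \<open>b\<close> into the kernel, so it vanishes at \<open>q\<close> and a
    q \<le> b q.\<close>
  have less: "\<phi> b < \<phi> a" if "a \<in> carrier ?H" "b \<in> carrier ?H" "b q < a q" for a b
  proof (rule ccontr)
    assume "\<not> ?thesis"
    then have "hdiff ?H a b \<in> K"
      using mcn_diff_closed[OF that(1,2)] diff[OF that(1,2)] unfolding K_def
      by (simp del: mcn_hoop_simps)
    then have "hdiff ?H a b q = 0"
      using q(2) unfolding point_ideal_def by blast
    with that(3) q(1) show False by simp
  qed
  have "\<phi> h = ?c * h q" if h: "h \<in> carrier ?H" for h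
  proof (rule ccontr)
    assume "\<phi> h \<noteq> ?c * h q"
    with c have "\<phi> h / ?c \<noteq> h q" by (simp add: field_simps)
    then consider "h q < \<phi> h / ?c" | "\<phi> h / ?c < h q" by linarith
    then show False
    proof cases
      case 1
      \<comment> \<open>The fraction \<open>m / k\<close> separates \<open>h q\<close> from
        \<open>\<phi> h / \<phi> one_fun\<close>; comparing the multiples k h and m \<one> at
        \<open>q\<close> through \<open>less\<close> then contradicts its upper inequality.\<close>
      have "0 \<le> h q" using h q(1) by simp
      then obtain m k :: nat where "real k * h q < real m" "real m < real k * (\<phi> h / ?c)"
        using ex_nat_fraction_between[OF _ 1] by blast
      moreover from this(1) have "real k * \<phi> h < real m * ?c"
        using less[OF mcn_multiple_closed[OF one_fun_carrier] mcn_multiple_closed[OF h], of k m] q(1)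
        by (simp add: hoop_multiple_mcn_apply mul[OF h] mul[OF one_fun_carrier]
            one_fun_def[THEN fun_cong, of q] del: mcn_hoop_simps)
      ultimately show False using c by (simp add: field_simps)
    next
      case 2
      have "0 \<le> \<phi> h / ?c" using nonneg[OF h] c by simp
      then obtain m k :: nat where "real k * (\<phi> h / ?c) < real m" "real m < real k * h q"
        using ex_nat_fraction_between[OF _ 2] by blast
      moreover from this(2) have "real m * ?c < real k * \<phi> h"
        using less[OF mcn_multiple_closed[OF h] mcn_multiple_closed[OF one_fun_carrier], of m k] q(1)
        by (simp add: hoop_multiple_mcn_apply mul[OF h] mul[OF one_fun_carrier]
            one_fun_def[THEN fun_cong, of q] del: mcn_hoop_simps)
      ultimately show False using c by (simp add: field_simps)
    qed
  qed
  with q(1) show thesis by (rule that)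
qed

section \<open>Nontrivial endomorphisms and their dual maps\<close>

lemma nontrivial_endo_eval_one_neq_0:
  fixes \<sigma> :: "(real ^ 'd::finite \<Rightarrow> real) \<Rightarrow> real ^ 'd \<Rightarrow> real"
  assumes sigma: "hoop_nontrivial_endo mcn_hoop \<sigma>" and p: "p \<in> unit_cube"
  shows "\<sigma> one_fun p \<noteq> 0"
proof
  let ?H = "mcn_hoop :: (real ^ 'd \<Rightarrow> real) hoop"
  have prime: "hoop_ideal ?H (point_ideal p)"
    using point_ideal_prime[OF p] by (simp only: hoop_prime_ideal_def)
  have closed: "\<sigma> a \<in> carrier ?H" if "a \<in> carrier ?H" for a
    using sigma that by (auto simp only: hoop_nontrivial_endo_def hoop_endo_def)
  have le: "hoop_le ?H (\<sigma> a) (\<sigma> b)" if "a \<in> carrier ?H" "b \<in> carrier ?H" "hoop_le ?H a b" for a b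
    using sigma that unfolding hoop_nontrivial_endo_def hoop_endo_def hoop_le_def by metis
  \<comment> \<open>Under this assumption all multiples of \<open>one_fun\<close> are mapped into
    \<open>point_ideal p\<close>. They dominate every element, so the whole image of
    \<open>\<sigma>\<close> lies in this prime ideal, against nontriviality.\<close>
  assume "\<sigma> one_fun p = 0"
  then have one: "\<sigma> one_fun \<in> point_ideal p"
    using closed[OF one_fun_carrier] unfolding point_ideal_def by blast
  have mul: "\<sigma> (hoop_multiple ?H k one_fun) \<in> point_ideal p" for k
  proof (induction k)
    case 0
    show ?case
      using sigma prime
      by (simp add: hoop_multiple_def hoop_nontrivial_endo_def hoop_endo_def hoop_ideal_def
          del: mcn_hoop_simps)
  next
    case (Suc k)
    have "hoop_multiple ?H (Suc k) one_fun = hplus ?H one_fun (hoop_multiple ?H k one_fun)"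
      by (simp add: hoop_multiple_def del: mcn_hoop_simps)
    then have "\<sigma> (hoop_multiple ?H (Suc k) one_fun)
        = hplus ?H (\<sigma> one_fun) (\<sigma> (hoop_multiple ?H k one_fun))"
      using sigma one_fun_carrier mcn_multiple_closed[OF one_fun_carrier, of k]
      unfolding hoop_nontrivial_endo_def hoop_endo_def by metis
    with Suc one prime show ?case
      by (simp add: hoop_ideal_def del: mcn_hoop_simps)
  qed
  have unit: "hoop_strong_unit ?H one_fun"
    by (intro mcn_strong_unitI one_fun_carrier) (simp add: one_fun_def)
  have "\<sigma> a \<in> point_ideal p" if a: "a \<in> carrier ?H" for a
  proof -
    obtain k where "hoop_le ?H a (hoop_multiple ?H k one_fun)"
      using unit a unfolding hoop_strong_unit_def by blast
    from le[OF a mcn_multiple_closed[OF one_fun_carrier] this] show ?thesis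
      using prime closed[OF a] mul[of k] unfolding hoop_ideal_def by blast
  qed
  then show False
    using sigma point_ideal_prime[OF p] unfolding hoop_nontrivial_endo_def by blast
qed

theorem theorem3p3:
  fixes \<sigma> :: "(real ^ 'd::finite \<Rightarrow> real) \<Rightarrow> (real ^ 'd \<Rightarrow> real)"
    and f :: "'d \<Rightarrow> real ^ 'd \<Rightarrow> real"
    and fn fsharp :: "real ^ 'd \<Rightarrow> real"
    and S :: "real ^ 'd \<Rightarrow> real ^ 'd"
  assumes sigma: "hoop_nontrivial_endo mcn_hoop \<sigma>"
    and f: "\<And>i. f i = \<sigma> (coord i)"
    and fn: "fn = \<sigma> last_gen"
    and fsharp: "fsharp = (\<lambda>p\<in>unit_cube. fn p + Max (range (\<lambda>i. f i p)))"
    and S: "\<And>p. S p = (\<chi> i. f i p / fsharp p)"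
  shows "fsharp = \<sigma> one_fun \<and>
         hoop_strong_unit mcn_hoop fsharp \<and>
         (\<forall>p\<in>unit_cube. fsharp p \<noteq> 0) \<and>
         (\<forall>p\<in>unit_cube. \<forall>i. 0 \<le> f i p \<and> f i p \<le> fsharp p) \<and>
         S \<in> unit_cube \<rightarrow> unit_cube \<and>
         bij_betw point_ideal (unit_cube :: (real ^ 'd) set) (hoop_max_spec mcn_hoop) \<and>
         (\<forall>p\<in>unit_cube. hoop_dual mcn_hoop \<sigma> (point_ideal p) = point_ideal (S p))"
proof -
  let ?H = "mcn_hoop :: (real ^ 'd \<Rightarrow> real) hoop"
  have endo: "hoop_endo ?H \<sigma>"
    using sigma by (simp only: hoop_nontrivial_endo_def)
  have closed: "\<sigma> a \<in> carrier ?H" if "a \<in> carrier ?H" for a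
    using endo that by (auto simp only: hoop_endo_def)
  have hom: "\<sigma> (hplus ?H a b) = hplus ?H (\<sigma> a) (\<sigma> b)" "\<sigma> (hdiff ?H a b) = hdiff ?H (\<sigma> a) (\<sigma> b)"
    if "a \<in> carrier ?H" "b \<in> carrier ?H" for a b
    using endo that by (auto simp only: hoop_endo_def)
  note neq0 = nontrivial_endo_eval_one_neq_0[OF sigma]
  \<comment> \<open>Applying \<open>\<sigma>\<close> and evaluating at \<open>p\<close> is a
    real-valued homomorphism, hence a scaled evaluation at some \<open>q\<close>. The formulas for
    \<open>f\<close>, \<open>fn\<close>, \<open>fsharp\<close> and the dual map are all instances of
    this identity.\<close>
  have "\<exists>q\<in>unit_cube. \<forall>h\<in>carrier ?H. \<sigma> h p = \<sigma> one_fun p * h q" if p: "p \<in> unit_cube" for p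
  proof (rule mcn_functional_is_evaluation[of "\<lambda>h. \<sigma> h p"])
    fix a b assume ab: "a \<in> carrier ?H" "b \<in> carrier ?H"
    show "\<sigma> (hplus ?H a b) p = \<sigma> a p + \<sigma> b p"
      unfolding hom[OF ab] using p by simp
    show "\<sigma> (hdiff ?H a b) p = max 0 (\<sigma> a p - \<sigma> b p)"
      unfolding hom[OF ab] using p by simp
  next
    fix a assume "a \<in> carrier ?H"
    from closed[OF this] p show "0 \<le> \<sigma> a p" by simp
  qed (use neq0[OF p] in blast)+
  then obtain Q where Q: "\<And>p. p \<in> unit_cube \<Longrightarrow> Q p \<in> unit_cube"
    and eval: "\<And>p h. p \<in> unit_cube \<Longrightarrow> h \<in> carrier ?H \<Longrightarrow> \<sigma> h p = \<sigma> one_fun p * h (Q p)"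
    by metis
  have pos: "\<sigma> one_fun p > 0" if "p \<in> unit_cube" for p
    using closed[OF one_fun_carrier] neq0[OF that] that by (simp add: less_le)
  have f_eval: "f i p = \<sigma> one_fun p * Q p $ i" if "p \<in> unit_cube" for i p
    using eval[OF that coord_carrier] Q[OF that] by (simp add: f coord_def)
  have sharp: "fsharp = \<sigma> one_fun"
  proof
    fix p :: "real ^ 'd"
    show "fsharp p = \<sigma> one_fun p"
    proof (cases "p \<in> unit_cube")
      case True
      \<comment> \<open>Scaling by a positive factor is monotone and so commutes with the finite
        maximum; adding \<open>fn p\<close> then cancels the maximum.\<close>
      have "mono (\<lambda>x. \<sigma> one_fun p * x)"
        using pos[OF True] by (intro monoI mult_left_mono) auto
      from mono_Max_commute[OF this, of "range (\<lambda>i. Q p $ i)"]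
      have "Max (range (\<lambda>i. f i p)) = \<sigma> one_fun p * Max (range (\<lambda>i. Q p $ i))"
        by (simp add: f_eval[OF True] image_image)
      moreover have "fn p = \<sigma> one_fun p * (1 - Max (range (\<lambda>i. Q p $ i)))"
        using eval[OF True last_gen_carrier] Q[OF True] by (simp add: fn last_gen_def)
      ultimately show ?thesis
        using True by (simp add: fsharp algebra_simps)
    next
      case False
      \<comment> \<open>Off the cube both sides are \<open>undefined\<close>, so the two functions
        are equal and not merely equal on the cube.\<close>
      moreover have "\<sigma> one_fun \<in> extensional unit_cube"
        using closed[OF one_fun_carrier] by (auto intro: mcnaughton_ext)
      ultimately show ?thesis
        by (simp add: fsharp extensional_def)
    qed
  qed
  \<comment> \<open>The common factor \<open>\<sigma> one_fun p\<close> cancels in each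
    quotient.\<close>
  have S_eq: "S p = Q p" if "p \<in> unit_cube" for p
    using neq0[OF that] by (simp add: S sharp f_eval[OF that] vec_eq_iff)
  have bounds: "0 \<le> f i p \<and> f i p \<le> fsharp p" if "p \<in> unit_cube" for i p
    using pos[OF that] Q[OF that]
    by (simp add: sharp f_eval[OF that] unit_cube_def mult_left_le)
  have dual: "hoop_dual ?H \<sigma> (point_ideal p) = point_ideal (S p)" if "p \<in> unit_cube" for p
  proof -
    \<comment> \<open>The factor \<open>\<sigma> one_fun p\<close> is nonzero, so
      \<open>\<sigma> h\<close> vanishes at \<open>p\<close> exactly when \<open>h\<close> vanishes
      at \<open>Q p\<close>.\<close>
    have "\<sigma> h \<in> point_ideal p \<longleftrightarrow> h (Q p) = 0" if h: "h \<in> carrier ?H" for h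
      using closed[OF h] eval[OF \<open>p \<in> unit_cube\<close> h] neq0[OF \<open>p \<in> unit_cube\<close>]
      unfolding point_ideal_def by simp
    then show ?thesis
      unfolding hoop_dual_def S_eq[OF that] by (auto simp only: point_ideal_def)
  qed
  have "hoop_strong_unit ?H fsharp"
    unfolding sharp by (intro mcn_strong_unitI closed one_fun_carrier neq0)
  moreover have "S \<in> unit_cube \<rightarrow> unit_cube"
    using Q S_eq by auto
  ultimately show ?thesis
    using sharp neq0 bounds dual bij_betw_point_ideal_max_spec by blast
qed

end
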